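(* Let $q$ be a prime power. Each of the following sets $\mathcal{S}$ is an optimal $(1,\mu)$-saturating set in $PG(2,q)$, with the stated size and $\mu$: (i) $\mathcal{S}$ is the union of $L$ distinct lines through a common point, where $2\le L\le q$; then $|\mathcal{S}|=1+Lq$ and $\mu=\binom{L}{2}q$. (ii) $\mathcal{S}$ is the union of $q$ distinct lines through a common point $G$ together with $b$ points, different from $G$, of the remaining $(q+1)$-th line through $G$, where $1\le b\le q-1$; then $|\mathcal{S}|=1+q^2+b$ and $\mu=\binom{b+1}{2}+\binom{q}{2}q$. (iii) $\mathcal{S}$ is a triangle, i.e. the union of three lines not through a common point; then $|\mathcal{S}|=3q$ and $\mu=3+(q-2)\binom{3}{2}=3(q-1)$. (iv) $\mathcal{S}=PG(2,q)\setminus T$, where $T$ is a vertex-less triangle, i.e. the union of three lines not through a common point with their three pairwise intersection points removed; then $|\mathcal{S}|=q^2-2q+4$ and $\mu=1+\binom{q}{2}+(q-1)\binom{q-2}{2}$.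
   Context: $PG(2,q)$ is the projective plane over $\mathbb{F}_q$. For a point set $\mathcal{S}$, a secant of $\mathcal{S}$ is a line $\ell$ with $|\ell\cap \mathcal{S}|\ge2$, counted with multiplicity $\binom{|\ell\cap \mathcal{S}|}{2}$. A set $\mathcal{S}$ of points of $PG(2,q)$ is $(1,\mu)$-saturating if (M1) $\mathcal{S}$ spans $PG(2,q)$, (M2) $\mathcal{S}\neq PG(2,q)$, and (M3) every point not in $\mathcal{S}$ lies on secants of $\mathcal{S}$ whose multiplicities sum to at least $\mu$; it is optimal if for every point not in $\mathcal{S}$ this sum is exactly $\mu$. *)

theory Defs
  imports Main "HOL-Library.Cardinality"
begin

text \<open>Vectors of F_q^3 are triples; PG(2,q) over a finite field type 'a with CARD('a) = q.
A point is the set of nonzero scalar multiples of a nonzero vector (a 1-dim subspace minus 0);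
a line is the set of points orthogonal (dot product 0) to a nonzero vector.\<close>

type_synonym 'a vec3 = "'a \<times> 'a \<times> 'a"

definition smul3 :: "'a::field \<Rightarrow> 'a vec3 \<Rightarrow> 'a vec3" where
  "smul3 c v = (case v of (x, y, z) \<Rightarrow> (c * x, c * y, c * z))"

definition add3 :: "'a::field vec3 \<Rightarrow> 'a vec3 \<Rightarrow> 'a vec3" where
  "add3 u v = (case u of (a, b, c) \<Rightarrow> case v of (x, y, z) \<Rightarrow> (a + x, b + y, c + z))"

definition dot3 :: "'a::field vec3 \<Rightarrow> 'a vec3 \<Rightarrow> 'a" where
  "dot3 u v = (case u of (a, b, c) \<Rightarrow> case v of (x, y, z) \<Rightarrow> a * x + b * y + c * z)"

definition pg_point :: "'a::field vec3 \<Rightarrow> 'a vec3 set" where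
  "pg_point v = {smul3 c v | c. c \<noteq> 0}"

definition pg_points :: "'a::field vec3 set set" where
  "pg_points = {pg_point v | v. v \<noteq> (0, 0, 0)}"

definition pg_line :: "'a::field vec3 \<Rightarrow> 'a vec3 set set" where
  "pg_line u = {pg_point v | v. v \<noteq> (0, 0, 0) \<and> dot3 u v = 0}"

definition pg_lines :: "'a::field vec3 set set set" where
  "pg_lines = {pg_line u | u. u \<noteq> (0, 0, 0)}"

text \<open>S spans PG(2,q): the vectors representing points of S span F_q^3.
(Any element of a span of a 3-dim space is a combination of 3 vectors of a spanning set.)\<close>
definition pg_spans :: "'a::field vec3 set set \<Rightarrow> bool" where
  "pg_spans S = (\<forall>x. \<exists>u v w a b c. pg_point u \<in> S \<and> pg_point v \<in> S \<and> pg_point w \<in> S \<and>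
      u \<noteq> (0,0,0) \<and> v \<noteq> (0,0,0) \<and> w \<noteq> (0,0,0) \<and>
      x = add3 (smul3 a u) (add3 (smul3 b v) (smul3 c w)))"

definition secant_sum :: "'a::field vec3 set set \<Rightarrow> 'a vec3 set \<Rightarrow> nat" where
  "secant_sum S P = (\<Sum>l \<in> {l \<in> pg_lines. P \<in> l \<and> 2 \<le> card (l \<inter> S)}. card (l \<inter> S) choose 2)"

definition saturating :: "'a::field vec3 set set \<Rightarrow> nat \<Rightarrow> bool" where
  "saturating S \<mu> = (S \<subseteq> pg_points \<and> pg_spans S \<and> S \<noteq> pg_points \<and>
      (\<forall>P \<in> pg_points - S. \<mu> \<le> secant_sum S P))"

definition optimal_saturating :: "'a::field vec3 set set \<Rightarrow> nat \<Rightarrow> bool" where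
  "optimal_saturating S \<mu> = (saturating S \<mu> \<and> (\<forall>P \<in> pg_points - S. secant_sum S P = \<mu>))"

end

theory Submission
  imports Defs
begin

text \<open>A point \<open>P\<close> lies on \<open>q + 1\<close> lines, and these partition the other points of the plane, so the
  secant multiplicities through \<open>P\<close> add up line by line. A line meets each line of a family
  through \<open>G\<close> in a different point unless it passes through \<open>G\<close> itself, so of the lines through
  \<open>P\<close> only \<open>PG\<close> is exceptional. For a triangle the exceptional lines are the three joining \<open>P\<close> to
  the vertices; for the complement of a vertex-less triangle they are the side containing \<open>P\<close> and
  the line joining \<open>P\<close> to the opposite vertex.\<close>

section \<open>Coordinates\<close>

text \<open>The cross product. Being orthogonal to both factors, it is the coordinate vector of the
  line joining two points and, dually, of the point where two lines meet.\<close>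

definition vcross :: "'a::field vec3 \<Rightarrow> 'a vec3 \<Rightarrow> 'a vec3" where
  "vcross u v = (case u of (a, b, c) \<Rightarrow> case v of (x, y, z) \<Rightarrow>
      (b * z - c * y, c * x - a * z, a * y - b * x))"

lemmas vec3_defs = smul3_def add3_def dot3_def vcross_def

lemma dot3_commute: "dot3 u v = dot3 v u"
  by (cases u; cases v) (simp add: vec3_defs mult.commute)

lemma dot3_smul3_right: "dot3 u (smul3 c v) = c * dot3 u v"
  by (cases u; cases v) (simp add: vec3_defs algebra_simps)

lemma dot3_add3_right: "dot3 u (add3 v w) = dot3 u v + dot3 u w"
  by (cases u; cases v; cases w) (simp add: vec3_defs algebra_simps)

lemma smul3_eq_zero_iff: "smul3 c v = (0, 0, 0) \<longleftrightarrow> c = 0 \<or> v = (0, 0, 0)"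
  by (cases v) (auto simp: vec3_defs)

lemma dot3_vcross_left: "dot3 u (vcross u v) = 0"
  by (cases u; cases v) (simp add: vec3_defs algebra_simps)

lemma dot3_vcross_right: "dot3 v (vcross u v) = 0"
  by (cases u; cases v) (simp add: vec3_defs algebra_simps)

text \<open>Lagrange's expansion of the triple product: both coefficients vanish. This is what makes
  a vector orthogonal to \<open>u\<close> and \<open>w\<close> parallel to
  \<open>vcross u w\<close>.\<close>

lemma vcross_vcross_eq_zero:
  assumes "dot3 u x = 0" "dot3 w x = 0"
  shows "vcross x (vcross u w) = (0, 0, 0)"
proof -
  have "vcross x (vcross u w) = add3 (smul3 (dot3 w x) u) (smul3 (- dot3 u x) w)"
    by (cases u; cases w; cases x) (simp add: vec3_defs algebra_simps)
  also have "\<dots> = (0, 0, 0)"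
    using assms by (cases u; cases w) (simp add: vec3_defs)
  finally show ?thesis .
qed

section \<open>Points as scalar classes, incidence, and the join and meet of points and
  lines\<close>

lemma smul3_smul3: "smul3 a (smul3 b v) = smul3 (a * b) v"
  by (cases v) (simp add: vec3_defs)

lemma smul3_one: "smul3 1 v = v"
  by (cases v) (simp add: vec3_defs)

lemma self_mem_pg_point: "v \<in> pg_point v"
  unfolding pg_point_def using smul3_one[of v] by (metis (mono_tags, lifting) CollectI one_neq_zero)

text \<open>Nonzero scalars form a group, so points are orbits and distinct points are disjoint sets
  of vectors.\<close>

lemma mem_pg_point_iff: "w \<in> pg_point v \<longleftrightarrow> pg_point w = pg_point v"
proof
  assume "w \<in> pg_point v"
  then obtain c where c: "c \<noteq> 0" "w = smul3 c v" by (auto simp: pg_point_def)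
  then have v: "v = smul3 (inverse c) w" by (simp add: smul3_smul3 smul3_one)
  show "pg_point w = pg_point v"
  proof (rule set_eqI)
    fix x
    have "x \<in> pg_point w" if "x \<in> pg_point v"
      using that v c unfolding pg_point_def
      by (smt (verit, best) mem_Collect_eq mult_eq_0_iff inverse_nonzero_iff_nonzero smul3_smul3)
    moreover have "x \<in> pg_point v" if "x \<in> pg_point w"
      using that c unfolding pg_point_def
      by (smt (verit, best) mem_Collect_eq mult_eq_0_iff smul3_smul3)
    ultimately show "x \<in> pg_point w \<longleftrightarrow> x \<in> pg_point v" by blast
  qed
qed (metis self_mem_pg_point)

lemma pg_point_eq_iff: "pg_point w = pg_point v \<longleftrightarrow> (\<exists>c. c \<noteq> 0 \<and> w = smul3 c v)"
  by (simp add: mem_pg_point_iff[symmetric]) (auto simp: pg_point_def)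

text \<open>Incidence is independent of the representative: scaling multiplies the dot product by a
  nonzero factor.\<close>

lemma dot3_eq_zero_cong:
  assumes "pg_point v = pg_point w"
  shows "dot3 u v = 0 \<longleftrightarrow> dot3 u w = 0"
  using assms by (auto simp: pg_point_eq_iff dot3_smul3_right)

lemma pg_point_mem_pg_line_iff:
  assumes "v \<noteq> (0, 0, 0)"
  shows "pg_point v \<in> pg_line u \<longleftrightarrow> dot3 u v = 0"
proof
  assume "pg_point v \<in> pg_line u"
  then obtain w where "pg_point v = pg_point w" "dot3 u w = 0" by (auto simp: pg_line_def)
  then show "dot3 u v = 0" using dot3_eq_zero_cong by blast
qed (use assms pg_line_def in blast)

lemma pg_pointsE:
  assumes "P \<in> pg_points"
  obtains v where "P = pg_point v" "v \<noteq> (0, 0, 0)"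
  using assms unfolding pg_points_def by blast

lemma pg_linesE:
  assumes "l \<in> pg_lines"
  obtains u where "l = pg_line u" "u \<noteq> (0, 0, 0)"
  using assms unfolding pg_lines_def by blast

lemma pg_lineE:
  assumes "P \<in> pg_line u"
  obtains v where "P = pg_point v" "v \<noteq> (0, 0, 0)" "dot3 u v = 0"
  using assms unfolding pg_line_def by blast

lemma pg_lineI: "u \<noteq> (0, 0, 0) \<Longrightarrow> pg_line u \<in> pg_lines"
  unfolding pg_lines_def by blast

lemma pg_line_subset: "pg_line u \<subseteq> pg_points"
  unfolding pg_line_def pg_points_def by blast

lemma pg_line_cong:
  assumes "pg_point u = pg_point w"
  shows "pg_line u = pg_line w"
  using dot3_eq_zero_cong[OF assms] by (simp add: pg_line_def dot3_commute)

text \<open>The cross product collects the 2x2 minors; when they vanish, dividing by a nonzero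
  coordinate of \<open>w\<close> gives the factor of proportionality.\<close>

lemma pg_point_eq_if_vcross_zero:
  assumes "v \<noteq> (0, 0, 0)" "w \<noteq> (0, 0, 0)" "vcross v w = (0, 0, 0)"
  shows "pg_point v = pg_point w"
proof -
  obtain x y z a b c where vw: "v = (x, y, z)" "w = (a, b, c)" by (metis prod_cases3)
  have eqs: "y * c = z * b" "z * a = x * c" "x * b = y * a"
    using assms(3) by (simp_all add: vw vcross_def)
  have "\<exists>d. v = smul3 d w"
  proof -
    consider "a \<noteq> 0" | "b \<noteq> 0" | "c \<noteq> 0" using assms(2) vw by auto
    then show ?thesis
    proof cases
      case 1
      then have "v = smul3 (x / a) w" using eqs by (simp add: vw smul3_def field_simps)
      then show ?thesis ..
    next
      case 2
      then have "v = smul3 (y / b) w" using eqs by (simp add: vw smul3_def field_simps)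
      then show ?thesis ..
    next
      case 3
      then have "v = smul3 (z / c) w" using eqs by (simp add: vw smul3_def field_simps)
      then show ?thesis ..
    qed
  qed
  \<comment> \<open>The factor cannot be 0, because \<open>v\<close> is not the zero vector.\<close>
  then show ?thesis using assms(1) by (metis pg_point_eq_iff smul3_eq_zero_iff)
qed

text \<open>A common point is orthogonal to \<open>u\<close> and \<open>w\<close>, so the triple
  product expansion makes it proportional to \<open>vcross u w\<close>, which is nonzero because
  \<open>u\<close> and \<open>w\<close> are not proportional.\<close>

lemma pg_line_Int:
  assumes "u \<noteq> (0, 0, 0)" "w \<noteq> (0, 0, 0)" "pg_point u \<noteq> pg_point w"
  shows "pg_line u \<inter> pg_line w = {pg_point (vcross u w)}"
proof -
  have nz: "vcross u w \<noteq> (0, 0, 0)"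
    using assms pg_point_eq_if_vcross_zero[of u w] by metis
  have "X = pg_point (vcross u w)" if X: "X \<in> pg_line u" "X \<in> pg_line w" for X
  proof -
    obtain x where x: "X = pg_point x" "x \<noteq> (0, 0, 0)" "dot3 u x = 0"
      using X(1) by (rule pg_lineE)
    then have "dot3 w x = 0" using X(2) by (simp add: pg_point_mem_pg_line_iff)
    then have "vcross x (vcross u w) = (0, 0, 0)" using x(3) by (simp only: vcross_vcross_eq_zero)
    then show ?thesis using x(1,2) nz by (metis pg_point_eq_if_vcross_zero)
  qed
  moreover have "pg_point (vcross u w) \<in> pg_line u \<inter> pg_line w"
    using nz by (simp add: pg_point_mem_pg_line_iff dot3_vcross_left dot3_vcross_right)
  ultimately show ?thesis by blast
qed

lemma pg_lines_meet:
  assumes "l \<in> pg_lines" "m \<in> pg_lines" "l \<noteq> m"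
  shows "\<exists>P. l \<inter> m = {P}"
proof -
  obtain u w where "l = pg_line u" "u \<noteq> (0, 0, 0)" "m = pg_line w" "w \<noteq> (0, 0, 0)"
    using assms(1,2) by (metis pg_linesE)
  then show ?thesis using assms(3) pg_line_Int[of u w] pg_line_cong[of u w] by metis
qed

text \<open>Dually to the meet, the cross product of two representatives is the coordinate vector of
  the joining line.\<close>

lemma pg_points_join:
  assumes "P \<in> pg_points" "Q \<in> pg_points" "P \<noteq> Q"
  shows "\<exists>l \<in> pg_lines. P \<in> l \<and> Q \<in> l"
proof -
  obtain v w where vw: "P = pg_point v" "v \<noteq> (0, 0, 0)" "Q = pg_point w" "w \<noteq> (0, 0, 0)"
    using assms(1,2) by (metis pg_pointsE)
  have "vcross v w \<noteq> (0, 0, 0)"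
    using vw assms(3) pg_point_eq_if_vcross_zero[of v w] by metis
  moreover have "P \<in> pg_line (vcross v w)" "Q \<in> pg_line (vcross v w)"
    using vw by (simp_all add: pg_point_mem_pg_line_iff dot3_commute[of "vcross v w"]
        dot3_vcross_left dot3_vcross_right)
  ultimately show ?thesis by (blast intro: pg_lineI)
qed

section \<open>Counts over a finite field\<close>

lemma card_pg_point:
  fixes v :: "'a::{finite,field} vec3"
  assumes "v \<noteq> (0, 0, 0)"
  shows "card (pg_point v) = CARD('a) - 1"
proof -
  have "pg_point v = (\<lambda>c. smul3 c v) ` (UNIV - {0})" unfolding pg_point_def by blast
  moreover have "inj_on (\<lambda>c. smul3 c v) (UNIV - {0})"
    using assms by (cases v) (auto simp: inj_on_def smul3_def)
  ultimately show ?thesis by (simp add: card_image card_Diff_singleton)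
qed

text \<open>A vector \<open>w\<close> with \<open>dot3 u w = 1\<close> splits the space uniquely
  into the kernel and the multiples of \<open>w\<close>, so q times the size of the kernel is
  q^3.\<close>

lemma card_dot3_kernel:
  fixes u :: "'a::{finite,field} vec3"
  assumes "u \<noteq> (0, 0, 0)"
  shows "card {v. dot3 u v = 0} = CARD('a) ^ 2"
proof -
  \<comment> \<open>The reciprocal of a nonzero coordinate of \<open>u\<close>, put in the same
    position, gives \<open>w\<close>.\<close>
  obtain w where w: "dot3 u w = 1"
  proof -
    obtain a b c where u: "u = (a, b, c)" by (metis prod_cases3)
    then consider "a \<noteq> 0" | "b \<noteq> 0" | "c \<noteq> 0" using assms by auto
    then show ?thesis
    proof cases
      case 1 then show ?thesis using u that[of "(1 / a, 0, 0)"] by (simp add: dot3_def)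
    next
      case 2 then show ?thesis using u that[of "(0, 1 / b, 0)"] by (simp add: dot3_def)
    next
      case 3 then show ?thesis using u that[of "(0, 0, 1 / c)"] by (simp add: dot3_def)
    qed
  qed
  let ?K = "{v. dot3 u v = 0}"
  have "bij_betw (\<lambda>(c, v). add3 v (smul3 c w)) (UNIV \<times> ?K) UNIV"
  \<comment> \<open>The inverse map reads off the multiple of \<open>w\<close> as
    \<open>dot3 u x\<close> and subtracts it to land in the kernel.\<close>
  proof (rule bij_betw_byWitness[where f' = "\<lambda>x. (dot3 u x, add3 x (smul3 (- dot3 u x) w))"])
    show "\<forall>a \<in> UNIV \<times> ?K. (\<lambda>x. (dot3 u x, add3 x (smul3 (- dot3 u x) w)))
        ((\<lambda>(c, v). add3 v (smul3 c w)) a) = a"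
    proof
      fix a :: "'a \<times> 'a vec3" assume "a \<in> UNIV \<times> ?K"
      then have a: "dot3 u (snd a) = 0" by auto
      have "add3 (add3 (snd a) (smul3 (fst a) w)) (smul3 (- fst a) w) = snd a"
        by (cases w; cases a) (simp add: smul3_def add3_def)
      then show "(\<lambda>x. (dot3 u x, add3 x (smul3 (- dot3 u x) w)))
          ((\<lambda>(c, v). add3 v (smul3 c w)) a) = a"
        using a by (simp add: case_prod_beta dot3_add3_right dot3_smul3_right w)
    qed
    show "\<forall>a' \<in> UNIV. (\<lambda>(c, v). add3 v (smul3 c w))
        (dot3 u a', add3 a' (smul3 (- dot3 u a') w)) = a'"
      by (cases w) (simp add: smul3_def add3_def)
  qed (simp_all add: image_subset_iff dot3_add3_right dot3_smul3_right w)
  then have "card (UNIV \<times> ?K :: ('a \<times> 'a vec3) set) = CARD('a vec3)"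
    by (rule bij_betw_same_card)
  then have "CARD('a) * card ?K = CARD('a) * CARD('a) ^ 2"
    by (simp add: card_cartesian_product power2_eq_square)
  then show ?thesis by simp
qed

text \<open>The points of the line partition the q^2 - 1 nonzero kernel vectors into classes of size
  q - 1.\<close>

lemma card_pg_line:
  fixes u :: "'a::{finite,field} vec3"
  assumes "u \<noteq> (0, 0, 0)"
  shows "card (pg_line u) = CARD('a) + 1"
proof -
  let ?K = "{v. v \<noteq> (0, 0, 0) \<and> dot3 u v = 0}"
  have q: "CARD('a) \<ge> 2"
    using card_mono[of UNIV "{0, 1 :: 'a}"] by simp
  have "\<Union>(pg_line u) = ?K"
  proof
    show "\<Union>(pg_line u) \<subseteq> ?K"
    proof
      fix x assume "x \<in> \<Union>(pg_line u)"
      then obtain v c where "x = smul3 c v" "c \<noteq> 0" "v \<noteq> (0, 0, 0)" "dot3 u v = 0"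
        unfolding pg_line_def pg_point_def by blast
      then show "x \<in> ?K" by (simp add: smul3_eq_zero_iff dot3_smul3_right)
    qed
    show "?K \<subseteq> \<Union>(pg_line u)"
      using self_mem_pg_point unfolding pg_line_def by blast
  qed
  moreover have "?K = {v. dot3 u v = 0} - {(0, 0, 0)}" by auto
  moreover have "dot3 u (0, 0, 0) = 0" by (cases u) (simp add: dot3_def)
  ultimately have K: "card (\<Union>(pg_line u)) = CARD('a) ^ 2 - 1"
    using card_dot3_kernel[OF assms] by (simp add: card_Diff_singleton)
  have "(CARD('a) - 1) * card (pg_line u) = card (\<Union>(pg_line u))"
  proof (rule card_partition)
    show "card X = CARD('a) - 1" if "X \<in> pg_line u" for X
      using that card_pg_point by (metis pg_lineE)
    show "X \<inter> Y = {}" if "X \<in> pg_line u" "Y \<in> pg_line u" "X \<noteq> Y" for X Y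
      using that mem_pg_point_iff by (metis disjoint_iff pg_lineE)
  qed simp_all
  also have "\<dots> = (CARD('a) - 1) * (CARD('a) + 1)"
    using K by (simp add: algebra_simps power2_eq_square)
  \<comment> \<open>The common factor q - 1 may be cancelled because q is at least 2.\<close>
  finally show ?thesis using q unfolding mult_cancel1 by linarith
qed

text \<open>Non-proportional vectors give lines sharing a single point, whereas a line has q + 1
  points.\<close>

lemma pg_line_eq_iff:
  fixes u w :: "'a::{finite,field} vec3"
  assumes "u \<noteq> (0, 0, 0)" "w \<noteq> (0, 0, 0)"
  shows "pg_line u = pg_line w \<longleftrightarrow> pg_point u = pg_point w"
proof
  assume eq: "pg_line u = pg_line w"
  show "pg_point u = pg_point w"
  proof (rule ccontr)
    assume "pg_point u \<noteq> pg_point w"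
    then have "card (pg_line u) = 1" using pg_line_Int[OF assms] eq by simp
    then show False using card_pg_line[OF assms(1)] by simp
  qed
qed (rule pg_line_cong)

lemma card_pg_lines_through:
  fixes P :: "'a::{finite,field} vec3 set"
  assumes "P \<in> pg_points"
  shows "card {l \<in> pg_lines. P \<in> l} = CARD('a) + 1"
proof -
  obtain v where v: "P = pg_point v" "v \<noteq> (0, 0, 0)"
    using assms by (rule pg_pointsE)
  \<comment> \<open>Duality: \<open>pg_point u \<mapsto> pg_line u\<close> is a bijection from the points of \<open>pg_line v\<close> to the lines
    through \<open>P\<close>; the choice of representative in \<open>?h\<close> is immaterial.\<close>
  let ?K = "{u. u \<noteq> (0, 0, 0) \<and> dot3 v u = 0}"
  let ?h = "\<lambda>X :: 'a vec3 set. pg_line (SOME u. u \<in> X)"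
  have h: "?h (pg_point u) = pg_line u" for u
    by (rule pg_line_cong) (metis mem_pg_point_iff someI_ex self_mem_pg_point)
  have "{l \<in> pg_lines. P \<in> l} = pg_line ` ?K"
    using v pg_point_mem_pg_line_iff[OF v(2)] dot3_commute[of v] unfolding pg_lines_def by auto
  also have "\<dots> = ?h ` pg_line v"
  proof -
    have "pg_line v = pg_point ` ?K" unfolding pg_line_def by blast
    then show ?thesis by (simp only: image_image h)
  qed
  also have "card \<dots> = card (pg_line v)"
    by (rule card_image, rule inj_onI) (metis h pg_lineE pg_line_eq_iff)
  finally show ?thesis using card_pg_line[OF v(2)] by simp
qed

section \<open>Criteria for spanning the plane\<close>

lemma pg_spans_if_not_collinear:
  fixes P Q R :: "'a::{finite,field} vec3 set"
  assumes S: "P \<in> S" "Q \<in> S" "R \<in> S" "S \<subseteq> pg_points"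
    and nc: "\<And>l. l \<in> pg_lines \<Longrightarrow> P \<in> l \<Longrightarrow> Q \<in> l \<Longrightarrow> R \<notin> l" and ne: "P \<noteq> Q"
  shows "pg_spans S"
proof -
  have "P \<in> pg_points" "Q \<in> pg_points" "R \<in> pg_points" using S by blast+
  then obtain u v w where uvw: "P = pg_point u" "u \<noteq> (0, 0, 0)" "Q = pg_point v" "v \<noteq> (0, 0, 0)"
      "R = pg_point w" "w \<noteq> (0, 0, 0)"
    by (elim pg_pointsE) blast
  \<comment> \<open>The determinant of three vectors. That \<open>R\<close> is off the line
    \<open>PQ\<close> says precisely that \<open>?d u v w\<close> is nonzero.\<close>
  let ?d = "\<lambda>x y z. dot3 (vcross x y) z"
  have n: "vcross u v \<noteq> (0, 0, 0)" using uvw ne pg_point_eq_if_vcross_zero[of u v] by metis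
  then have "pg_line (vcross u v) \<in> pg_lines" by (rule pg_lineI)
  moreover have "P \<in> pg_line (vcross u v)" "Q \<in> pg_line (vcross u v)"
    using uvw by (simp_all add: pg_point_mem_pg_line_iff dot3_commute[of "vcross u v"]
        dot3_vcross_left dot3_vcross_right)
  ultimately have "R \<notin> pg_line (vcross u v)" by (rule nc)
  then have D: "?d u v w \<noteq> 0" using uvw by (simp add: pg_point_mem_pg_line_iff)
  have "x = add3 (smul3 (?d x v w / ?d u v w) u)
      (add3 (smul3 (?d u x w / ?d u v w) v) (smul3 (?d u v x / ?d u v w) w))" for x
  proof -
    \<comment> \<open>Cramer's rule in division-free form, a polynomial identity in the coordinates;
      the determinant is divided out afterwards.\<close>
    have cramer: "smul3 (?d u v w) x = add3 (smul3 (?d x v w) u)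
        (add3 (smul3 (?d u x w) v) (smul3 (?d u v x) w))"
      by (cases u; cases v; cases w; cases x) (simp add: vec3_defs algebra_simps)
    have "x = smul3 (inverse (?d u v w)) (smul3 (?d u v w) x)"
      using D by (simp add: smul3_smul3 smul3_one)
    also have "\<dots> = add3 (smul3 (?d x v w / ?d u v w) u)
      (add3 (smul3 (?d u x w / ?d u v w) v) (smul3 (?d u v x / ?d u v w) w))"
      unfolding cramer divide_inverse
      by (cases u; cases v; cases w) (simp add: smul3_def add3_def algebra_simps)
    finally show ?thesis .
  qed
  moreover have "pg_point u \<in> S" "pg_point v \<in> S" "pg_point w \<in> S"
    using S(1-3) uvw by simp_all
  ultimately show ?thesis
    unfolding pg_spans_def using uvw(2,4,6) by (intro allI exI conjI)
qed

text \<open>The common point of the two lines and one further point on each of them form a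
  non-collinear triple.\<close>

lemma pg_spans_if_two_lines:
  fixes l m :: "'a::{finite,field} vec3 set set"
  assumes "l \<in> pg_lines" "m \<in> pg_lines" "l \<noteq> m" "l \<subseteq> S" "m \<subseteq> S" "S \<subseteq> pg_points"
  shows "pg_spans S"
proof -
  obtain G where G: "l \<inter> m = {G}" using pg_lines_meet[OF assms(1-3)] ..
  have c: "card k = CARD('a) + 1" if "k \<in> pg_lines" for k :: "'a vec3 set set"
    using that by (rule pg_linesE) (simp add: card_pg_line)
  have "\<not> l \<subseteq> {G}" "\<not> m \<subseteq> {G}"
    using card_mono[of "{G}" l] card_mono[of "{G}" m] c[OF assms(1)] c[OF assms(2)] by auto
  then obtain X Y where XY: "X \<in> l" "X \<noteq> G" "Y \<in> m" "Y \<noteq> G" by blast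
  have "Y \<notin> k" if k: "k \<in> pg_lines" "G \<in> k" "X \<in> k" for k
  proof -
    have "k = l"
      using pg_lines_meet[OF k(1) assms(1)] k XY(1,2) G by (metis IntD1 IntI insertI1 singletonD)
    then show ?thesis using XY(3,4) G by (metis IntI singletonD)
  qed
  moreover have "G \<in> S" "X \<in> S" "Y \<in> S" using G XY assms(4,5) by blast+
  ultimately show ?thesis using XY(2)[symmetric] assms(6) by (intro pg_spans_if_not_collinear)
qed

section \<open>Counting in a finite projective plane\<close>

text \<open>The incidence facts and the two counts obtained above in coordinates serve as axioms, so
  that the secant counts are free of vectors.\<close>

locale finite_projective_plane =
  fixes Pts :: "'p set" and Lns :: "'p set set" and q :: nat
  assumes finite_Pts: "finite Pts"
    and line_subset: "l \<in> Lns \<Longrightarrow> l \<subseteq> Pts"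
    and join: "P \<in> Pts \<Longrightarrow> Q \<in> Pts \<Longrightarrow> P \<noteq> Q \<Longrightarrow> \<exists>l \<in> Lns. P \<in> l \<and> Q \<in> l"
    and meet: "l \<in> Lns \<Longrightarrow> m \<in> Lns \<Longrightarrow> l \<noteq> m \<Longrightarrow> \<exists>P. l \<inter> m = {P}"
    and card_line: "l \<in> Lns \<Longrightarrow> card l = q + 1"
    and card_lines_through: "P \<in> Pts \<Longrightarrow> card {l \<in> Lns. P \<in> l} = q + 1"
    and order_ge_2: "2 \<le> q"
begin

definition pencil :: "'p \<Rightarrow> 'p set set" where
  "pencil P = {l \<in> Lns. P \<in> l}"

text \<open>The sum runs over all lines through \<open>P\<close>: a line with fewer than two points
  of \<open>S\<close> adds 0, so the value is that of \<open>secant_sum\<close>, and the index set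
  has the known size q + 1.\<close>

definition secants :: "'p set \<Rightarrow> 'p \<Rightarrow> nat" where
  "secants S P = (\<Sum>l \<in> pencil P. card (l \<inter> S) choose 2)"

lemma card_pencil: "P \<in> Pts \<Longrightarrow> card (pencil P) = q + 1"
  unfolding pencil_def by (rule card_lines_through)

lemma finite_line: "l \<in> Lns \<Longrightarrow> finite l"
  using line_subset finite_Pts finite_subset by blast

lemma finite_pencil: "finite (pencil P)"
proof -
  have "pencil P \<subseteq> Pow Pts" using line_subset by (auto simp: pencil_def)
  then show ?thesis using finite_Pts finite_subset by blast
qed

lemma line_unique:
  assumes "l \<in> Lns" "m \<in> Lns" "X \<in> l" "Y \<in> l" "X \<in> m" "Y \<in> m" "X \<noteq> Y"
  shows "l = m"
proof (rule ccontr)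
  assume "l \<noteq> m"
  then obtain P where "l \<inter> m = {P}" using meet assms(1,2) by blast
  then show False using assms(3-7) by (metis IntI singletonD)
qed

lemma Int_eq_singleton:
  assumes "l \<in> Lns" "m \<in> Lns" "l \<noteq> m" "P \<in> l" "P \<in> m"
  shows "l \<inter> m = {P}"
  using meet[OF assms(1-3)] assms(4,5) by (metis IntI singletonD)

lemma card_Int_line: "l \<in> Lns \<Longrightarrow> m \<in> Lns \<Longrightarrow> l \<noteq> m \<Longrightarrow> card (l \<inter> m) = 1"
  using meet by fastforce

lemma pencil_join:
  assumes "P \<in> Pts" "Q \<in> Pts" "P \<noteq> Q"
  shows "\<exists>l \<in> pencil P. Q \<in> l"
  using join[OF assms] unfolding pencil_def by blast

lemma Union_pencil:
  assumes "G \<in> Pts"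
  shows "\<Union>(pencil G) = Pts"
proof
  show "\<Union>(pencil G) \<subseteq> Pts" using line_subset by (auto simp: pencil_def)
  show "Pts \<subseteq> \<Union>(pencil G)"
  proof
    fix P assume P: "P \<in> Pts"
    show "P \<in> \<Union>(pencil G)"
    proof (cases "P = G")
      case True
      have "pencil G \<noteq> {}" using card_pencil[OF assms] by auto
      then show ?thesis using True by (auto simp: pencil_def)
    qed (use assms P pencil_join in auto)
  qed
qed

section \<open>Families of concurrent lines\<close>

lemma card_Union_concurrent:
  assumes "Ls \<subseteq> pencil G" "Ls \<noteq> {}"
  shows "card (\<Union>Ls) = 1 + card Ls * q"
proof -
  have L: "l \<in> Lns" "G \<in> l" if "l \<in> Ls" for l using that assms(1) by (auto simp: pencil_def)
  have fin: "finite Ls" using assms(1) finite_pencil finite_subset by blast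
  \<comment> \<open>Without \<open>G\<close> the lines become disjoint sets of q points
    each.\<close>
  have "card (\<Union>l\<in>Ls. l - {G}) = (\<Sum>l\<in>Ls. card (l - {G}))"
  proof (rule card_UN_disjoint)
    show "\<forall>l\<in>Ls. \<forall>m\<in>Ls. l \<noteq> m \<longrightarrow> (l - {G}) \<inter> (m - {G}) = {}"
      using L Int_eq_singleton by blast
  qed (use fin L finite_line in auto)
  also have "\<dots> = card Ls * q" using L card_line finite_line by simp
  finally have "card (insert G (\<Union>l\<in>Ls. l - {G})) = 1 + card Ls * q"
    using fin L finite_line by (subst card_insert_disjoint) auto
  \<comment> \<open>Nonemptiness of \<open>Ls\<close> is what puts \<open>G\<close> into the
    union.\<close>
  moreover have "insert G (\<Union>l\<in>Ls. l - {G}) = \<Union>Ls" using L assms(2) by auto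
  ultimately show ?thesis by simp
qed

lemma card_Pts:
  assumes "G \<in> Pts"
  shows "card Pts = 1 + (q + 1) * q"
proof -
  have "pencil G \<noteq> {}" using card_pencil[OF assms] by auto
  then show ?thesis
    using card_Union_concurrent[of "pencil G" G] Union_pencil[OF assms] card_pencil[OF assms] by simp
qed

text \<open>Each line of the family meets \<open>m\<close> in one point, and these points differ
  because two lines of the family share only \<open>G\<close>, which is not on
  \<open>m\<close>.\<close>

lemma card_Int_Union_concurrent:
  assumes "Ls \<subseteq> pencil G" "m \<in> Lns" "G \<notin> m"
  shows "card (m \<inter> \<Union>Ls) = card Ls"
proof -
  have L: "l \<in> Lns" "G \<in> l" "l \<noteq> m" if "l \<in> Ls" for l
    using that assms by (auto simp: pencil_def)
  have fin: "finite Ls" using assms(1) finite_pencil finite_subset by blast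
  have "card (\<Union>l\<in>Ls. m \<inter> l) = (\<Sum>l\<in>Ls. card (m \<inter> l))"
  proof (rule card_UN_disjoint)
    have "l \<inter> k = {G}" if "l \<in> Ls" "k \<in> Ls" "l \<noteq> k" for l k
      using that L by (intro Int_eq_singleton)
    then show "\<forall>l\<in>Ls. \<forall>k\<in>Ls. l \<noteq> k \<longrightarrow> (m \<inter> l) \<inter> (m \<inter> k) = {}"
      using assms(3) by (simp add: inf.left_commute inf.assoc)
  qed (use fin assms(2) finite_line in auto)
  also have "\<dots> = (\<Sum>l\<in>Ls. 1)"
    using L assms(2) by (intro sum.cong refl card_Int_line) (simp_all add: eq_commute[of m])
  finally show ?thesis by (simp flip: Int_UN_distrib)
qed

text \<open>The bookkeeping behind every value of mu: \<open>K\<close> holds the exceptional lines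
  through \<open>P\<close>, and all other lines through \<open>P\<close> contribute the same
  amount.\<close>

lemma sum_pencil_const:
  fixes f :: "'p set \<Rightarrow> nat"
  assumes "P \<in> Pts" "K \<subseteq> pencil P" "\<And>l. l \<in> pencil P - K \<Longrightarrow> f l = k"
  shows "sum f (pencil P) = sum f K + (q + 1 - card K) * k"
proof -
  have "sum f (pencil P) = sum f (pencil P - K) + sum f K"
    by (rule sum.subset_diff[OF assms(2) finite_pencil])
  moreover have "sum f (pencil P - K) = card (pencil P - K) * k"
    using assms(3) by simp
  moreover have "card (pencil P - K) = q + 1 - card K"
    using assms(1,2) card_pencil finite_pencil by (simp add: card_Diff_subset finite_subset)
  ultimately show ?thesis by simp
qed

text \<open>The line \<open>PG\<close> is not in the family, as \<open>P\<close> is uncovered, so it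
  meets the union only in \<open>G\<close> and adds 0. Each of the other q lines carries one point
  per line of the family.\<close>

lemma secants_concurrent_lines:
  assumes "G \<in> Pts" "Ls \<subseteq> pencil G" "Ls \<noteq> {}" "P \<in> Pts - \<Union>Ls"
  shows "secants (\<Union>Ls) P = (card Ls choose 2) * q"
proof -
  have "P \<noteq> G" using assms by (auto simp: pencil_def)
  then obtain m where m: "m \<in> pencil P" "G \<in> m" using assms pencil_join[of P G] by auto
  have "m \<inter> l = {G}" if "l \<in> Ls" for l
    using that m assms(2,4) by (intro Int_eq_singleton) (auto simp: pencil_def)
  then have "m \<inter> \<Union>Ls = {G}" using assms(3) by (simp add: Int_Union)
  then have 1: "card (m \<inter> \<Union>Ls) choose 2 = 0" by simp
  have 2: "card (l \<inter> \<Union>Ls) choose 2 = card Ls choose 2" if "l \<in> pencil P - {m}" for l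
  proof -
    have "G \<notin> l" using that m \<open>P \<noteq> G\<close> line_unique[of l m G P] by (auto simp: pencil_def)
    then show ?thesis using that card_Int_Union_concurrent[OF assms(2)] by (simp add: pencil_def)
  qed
  show ?thesis
    unfolding secants_def using sum_pencil_const[of P "{m}", OF _ _ 2] assms(4) m(1) 1 by simp
qed

text \<open>Used to place every point missed by the q lines on the remaining line
  \<open>m\<close>.\<close>

lemma insert_eq_pencil:
  assumes "G \<in> Pts" "Ls \<subseteq> pencil G" "card Ls = q" "m \<in> pencil G" "m \<notin> Ls"
  shows "insert m Ls = pencil G"
proof (rule card_subset_eq)
  have "finite Ls" using assms(2) finite_pencil finite_subset by blast
  then show "card (insert m Ls) = card (pencil G)" using assms card_pencil by simp
qed (use assms finite_pencil in auto)

lemma card_concurrent_lines_Un_points: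
  assumes "Ls \<subseteq> pencil G" "Ls \<noteq> {}" "m \<in> pencil G" "m \<notin> Ls" "B \<subseteq> m - {G}"
  shows "card (\<Union>Ls \<union> B) = 1 + card Ls * q + card B"
proof -
  have L: "l \<in> Lns" "G \<in> l" if "l \<in> Ls" for l using that assms(1) by (auto simp: pencil_def)
  have m: "m \<in> Lns" "G \<in> m" using assms(3) by (auto simp: pencil_def)
  have "l \<inter> m = {G}" if "l \<in> Ls" for l
    using that L m assms(4) by (intro Int_eq_singleton) auto
  then have "\<Union>Ls \<inter> m = {G}" using assms(2) by (simp add: Int_Union2)
  then have "\<Union>Ls \<inter> B = {}" using assms(5) by auto
  moreover have "finite (\<Union>Ls)"
    using L line_subset finite_Pts by (meson Sup_least finite_subset)
  moreover have "finite B" using assms(5) m finite_line finite_subset by blast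
  ultimately show ?thesis using card_Union_concurrent[OF assms(1,2)] by (simp add: card_Un_disjoint)
qed

text \<open>\<open>P\<close> must lie on \<open>m\<close>, which carries \<open>B\<close> and
  \<open>G\<close>. The other q lines through \<open>P\<close> meet \<open>m\<close> only in
  \<open>P\<close>, hence avoid both \<open>G\<close> and \<open>B\<close> and have q points in the
  set.\<close>

lemma secants_concurrent_lines_Un_points:
  assumes G: "G \<in> Pts" and Ls: "Ls \<subseteq> pencil G" "card Ls = q"
    and m: "m \<in> pencil G" "m \<notin> Ls" and B: "B \<subseteq> m - {G}"
    and P: "P \<in> Pts - (\<Union>Ls \<union> B)"
  shows "secants (\<Union>Ls \<union> B) P = ((card B + 1) choose 2) + (q choose 2) * q"
proof -
  have L: "l \<in> Lns" "G \<in> l" if "l \<in> Ls" for l using that Ls(1) by (auto simp: pencil_def)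
  have m': "m \<in> Lns" "G \<in> m" using m(1) by (auto simp: pencil_def)
  have ne: "Ls \<noteq> {}" using Ls(2) order_ge_2 by auto
  have "P \<in> \<Union>(insert m Ls)"
    using insert_eq_pencil[OF G Ls m] Union_pencil[OF G] P by simp
  then have "P \<in> m" using P by blast
  have "P \<noteq> G" using P ne L(2) by blast
  have "m \<inter> l = {G}" if "l \<in> Ls" for l
    using that L m' m(2) by (intro Int_eq_singleton) auto
  then have "m \<inter> \<Union>Ls = {G}" using ne by (simp add: Int_Union)
  moreover have "m \<inter> B = B" using B by blast
  ultimately have "m \<inter> (\<Union>Ls \<union> B) = insert G B" by (simp add: Int_Un_distrib)
  moreover have "finite B" using B m' finite_line finite_subset by blast
  ultimately have 1: "card (m \<inter> (\<Union>Ls \<union> B)) = card B + 1"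
    using B by (auto simp: card_insert_if)
  have 2: "card (l \<inter> (\<Union>Ls \<union> B)) choose 2 = q choose 2" if "l \<in> pencil P - {m}" for l
  proof -
    have l: "l \<in> Lns" "P \<in> l" "l \<noteq> m" using that by (auto simp: pencil_def)
    then have lm: "l \<inter> m = {P}" using \<open>P \<in> m\<close> m' by (intro Int_eq_singleton) auto
    then have "G \<notin> l" using m' \<open>P \<noteq> G\<close> by (metis IntI singletonD)
    have "X \<notin> B" if "X \<in> l" for X
    proof
      assume X: "X \<in> B"
      then have "X \<in> l \<inter> m" using that B by blast
      then show False using X P lm by simp
    qed
    then have "l \<inter> (\<Union>Ls \<union> B) = l \<inter> \<Union>Ls" by blast
    then show ?thesis
      using card_Int_Union_concurrent[OF Ls(1) l(1) \<open>G \<notin> l\<close>] Ls(2) by simp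
  qed
  have "m \<in> pencil P" using m' \<open>P \<in> m\<close> by (simp add: pencil_def)
  then show ?thesis
    unfolding secants_def using sum_pencil_const[of P "{m}", OF _ _ 2] P 1 by simp
qed

section \<open>Triangles\<close>

lemma triangleE:
  assumes "l1 \<in> Lns" "l2 \<in> Lns" "l3 \<in> Lns" "l1 \<inter> l2 \<inter> l3 = {}"
  obtains A B C where "l2 \<inter> l3 = {A}" "l1 \<inter> l3 = {B}" "l1 \<inter> l2 = {C}"
    "A \<in> l2" "A \<in> l3" "A \<notin> l1" "B \<in> l1" "B \<in> l3" "B \<notin> l2" "C \<in> l1" "C \<in> l2" "C \<notin> l3"
proof -
  \<comment> \<open>Covering the case \<open>l = m\<close> too, this forces the sides apart: if two
    of them coincided, their meet with the third would lie on all three.\<close>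
  have ne: "l \<inter> m \<noteq> {}" if "l \<in> Lns" "m \<in> Lns" for l m
  proof (cases "l = m")
    case True
    then show ?thesis using card_line[OF that(1)] by auto
  qed (use meet[OF that] in auto)
  have "l1 \<noteq> l2" using ne[of l1 l3] assms by blast
  moreover have "l1 \<noteq> l3" using ne[of l1 l2] assms by blast
  moreover have "l2 \<noteq> l3" using ne[of l1 l2] assms by blast
  \<comment> \<open>The vertices \<open>A\<close>, \<open>B\<close>, \<open>C\<close> are opposite
    to \<open>l1\<close>, \<open>l2\<close>, \<open>l3\<close> respectively.\<close>
  ultimately obtain A B C where ABC: "l2 \<inter> l3 = {A}" "l1 \<inter> l3 = {B}" "l1 \<inter> l2 = {C}"
    using meet assms(1-3) by metis
  then have "A \<in> l2 \<inter> l3" "B \<in> l1 \<inter> l3" "C \<in> l1 \<inter> l2" by simp_all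
  with ABC show ?thesis using assms(4) by (intro that[of A B C]) blast+
qed

text \<open>Both sides through \<open>A\<close> meet \<open>m\<close> only in \<open>A\<close>; the
  opposite side \<open>l1\<close> supplies the second point.\<close>

lemma card_Int_triangle_vertex:
  assumes "l1 \<in> Lns" "l2 \<in> Lns" "l3 \<in> Lns" "A \<in> l2" "A \<in> l3" "A \<notin> l1"
    and "m \<in> Lns" "A \<in> m" "m \<noteq> l2" "m \<noteq> l3"
  shows "card (m \<inter> (l1 \<union> l2 \<union> l3)) = 2"
proof -
  have A: "m \<inter> l2 = {A}" "m \<inter> l3 = {A}" using assms by (simp_all add: Int_eq_singleton)
  have "m \<noteq> l1" using assms by blast
  then obtain X where X: "m \<inter> l1 = {X}" using meet assms(1,7) by blast
  then have "X \<in> m \<inter> l1" by simp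
  then have "X \<noteq> A" using assms(6) by auto
  moreover have "m \<inter> (l1 \<union> l2 \<union> l3) = {X, A}" by (auto simp: Int_Un_distrib A X)
  ultimately show ?thesis by simp
qed

text \<open>The meets with the three sides are distinct, since a coincidence would be a vertex on
  \<open>m\<close>.\<close>

lemma card_Int_triangle_no_vertex:
  assumes "l1 \<in> Lns" "l2 \<in> Lns" "l3 \<in> Lns" "m \<in> Lns" "m \<noteq> l1" "m \<noteq> l2" "m \<noteq> l3"
    and "m \<inter> (l2 \<inter> l3) = {}" "m \<inter> (l1 \<inter> l3) = {}" "m \<inter> (l1 \<inter> l2) = {}"
  shows "card (m \<inter> (l1 \<union> l2 \<union> l3)) = 3"
proof -
  obtain X Y Z where XYZ: "m \<inter> l1 = {X}" "m \<inter> l2 = {Y}" "m \<inter> l3 = {Z}"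
    using meet[OF assms(4,1,5)] meet[OF assms(4,2,6)] meet[OF assms(4,3,7)] by blast
  then have "X \<in> m \<inter> l1" "Y \<in> m \<inter> l2" "Z \<in> m \<inter> l3" by simp_all
  then have "X \<noteq> Y" "X \<noteq> Z" "Y \<noteq> Z" using assms(8-10) by auto
  moreover have "m \<inter> (l1 \<union> l2 \<union> l3) = {X, Y, Z}" by (auto simp: Int_Un_distrib XYZ)
  ultimately show ?thesis by simp
qed

text \<open>Two sides cover 2q + 1 points; the third has q + 1, of which the two vertices
  \<open>A\<close> and \<open>B\<close> are already counted.\<close>

lemma card_triangle:
  assumes "l1 \<in> Lns" "l2 \<in> Lns" "l3 \<in> Lns" "l1 \<inter> l2 \<inter> l3 = {}"
  shows "card (l1 \<union> l2 \<union> l3) = 3 * q"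
proof -
  obtain A B C where eqs: "l2 \<inter> l3 = {A}" "l1 \<inter> l3 = {B}" "l1 \<inter> l2 = {C}"
    and mem: "A \<in> l2" "A \<in> l3" "A \<notin> l1" "B \<in> l1" "B \<in> l3" "B \<notin> l2" "C \<in> l1" "C \<in> l2" "C \<notin> l3"
    using assms by (rule triangleE)
  have "l1 \<noteq> l2" "A \<noteq> B" using mem by blast+
  have "{l1, l2} \<subseteq> pencil C" using mem assms by (simp add: pencil_def)
  then have 12: "card (l1 \<union> l2) = 1 + 2 * q"
    using card_Union_concurrent[of "{l1, l2}" C] \<open>l1 \<noteq> l2\<close> by simp
  have "card ((l1 \<union> l2) \<inter> l3) = 2"
    using \<open>A \<noteq> B\<close> by (simp add: Int_Un_distrib2 eqs)
  moreover have "card (l1 \<union> l2) + card l3 = card (l1 \<union> l2 \<union> l3) + card ((l1 \<union> l2) \<inter> l3)"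
    using assms finite_line by (intro card_Un_Int) auto
  ultimately show ?thesis using 12 card_line[OF assms(3)] by simp
qed

text \<open>The lines \<open>PA\<close>, \<open>PB\<close>, \<open>PC\<close> have two points in the
  triangle and add 1 each; the remaining q - 2 lines through \<open>P\<close> have three and add 3
  each.\<close>

lemma secants_triangle:
  assumes "l1 \<in> Lns" "l2 \<in> Lns" "l3 \<in> Lns" "l1 \<inter> l2 \<inter> l3 = {}"
    and P: "P \<in> Pts - (l1 \<union> l2 \<union> l3)"
  shows "secants (l1 \<union> l2 \<union> l3) P = 3 * (q - 1)"
proof -
  obtain A B C where eqs: "l2 \<inter> l3 = {A}" "l1 \<inter> l3 = {B}" "l1 \<inter> l2 = {C}"
    and mem: "A \<in> l2" "A \<in> l3" "A \<notin> l1" "B \<in> l1" "B \<in> l3" "B \<notin> l2" "C \<in> l1" "C \<in> l2" "C \<notin> l3"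
    using assms(1-4) by (rule triangleE)
  have pts: "A \<in> Pts" "B \<in> Pts" "C \<in> Pts" "P \<in> Pts" "P \<noteq> A" "P \<noteq> B" "P \<noteq> C"
      "A \<noteq> B" "A \<noteq> C" "B \<noteq> C"
    using mem P line_subset[OF assms(1)] line_subset[OF assms(2)] by blast+
  obtain a where a: "a \<in> pencil P" "A \<in> a" using pts pencil_join[of P A] by auto
  obtain b where b: "b \<in> pencil P" "B \<in> b" using pts pencil_join[of P B] by auto
  obtain c where c: "c \<in> pencil P" "C \<in> c" using pts pencil_join[of P C] by auto
  have off: "k \<in> Lns" "P \<in> k" "k \<noteq> l1" "k \<noteq> l2" "k \<noteq> l3" if "k \<in> pencil P" for k
    using that P by (auto simp: pencil_def)
  \<comment> \<open>A line through two vertices is a side, and no side contains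
    \<open>P\<close>.\<close>
  have dist: "a \<noteq> b" "a \<noteq> c" "b \<noteq> c"
    using line_unique[of a l3 A B] line_unique[of a l2 A C] line_unique[of b l1 B C]
      mem pts a b c off[OF a(1)] off[OF b(1)] assms(1-3) by blast+
  let ?S = "l1 \<union> l2 \<union> l3"
  have "card (a \<inter> ?S) = 2"
    by (rule card_Int_triangle_vertex[where A = A]) (use a(2) off[OF a(1)] mem assms(1-3) in simp_all)
  \<comment> \<open>The sides are reordered so that the one opposite to the vertex comes
    first.\<close>
  moreover have "card (b \<inter> (l2 \<union> l1 \<union> l3)) = 2"
    by (rule card_Int_triangle_vertex[where A = B]) (use b(2) off[OF b(1)] mem assms(1-3) in simp_all)
  moreover have "card (c \<inter> (l3 \<union> l1 \<union> l2)) = 2"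
    by (rule card_Int_triangle_vertex[where A = C]) (use c(2) off[OF c(1)] mem assms(1-3) in simp_all)
  ultimately have 1: "(\<Sum>l\<in>{a, b, c}. card (l \<inter> ?S) choose 2) = 3"
    using dist by (simp add: Un_ac)
  have 2: "card (l \<inter> ?S) choose 2 = 3" if "l \<in> pencil P - {a, b, c}" for l
  proof -
    have l: "l \<in> pencil P" "l \<noteq> a" "l \<noteq> b" "l \<noteq> c" using that by auto
    have "A \<notin> l" using line_unique[of l a P A] pts l a off[OF l(1)] off[OF a(1)] by blast
    moreover have "B \<notin> l" using line_unique[of l b P B] pts l b off[OF l(1)] off[OF b(1)] by blast
    moreover have "C \<notin> l" using line_unique[of l c P C] pts l c off[OF l(1)] off[OF c(1)] by blast
    ultimately have "card (l \<inter> ?S) = 3"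
      by (intro card_Int_triangle_no_vertex) (use off[OF l(1)] assms(1-3) in \<open>simp_all add: eqs\<close>)
    then show ?thesis by (simp add: numeral_eq_Suc)
  qed
  \<comment> \<open>The truncated difference is exact because q is at least 2; for q = 2 only the
    three vertex lines pass through \<open>P\<close>.\<close>
  have "secants ?S P = 3 + (q + 1 - 3) * 3"
    unfolding secants_def
    using sum_pencil_const[of P "{a, b, c}", OF _ _ 2] pts(4) a(1) b(1) c(1) 1 dist by simp
  then show ?thesis using order_ge_2 by simp
qed

section \<open>Vertex-less triangles and their complements\<close>

abbreviation (input) vertexless_triangle :: "'p set \<Rightarrow> 'p set \<Rightarrow> 'p set \<Rightarrow> 'p set" where
  "vertexless_triangle l1 l2 l3 \<equiv>
    (l1 \<union> l2 \<union> l3) - ((l1 \<inter> l2) \<union> (l1 \<inter> l3) \<union> (l2 \<inter> l3))"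

lemma card_vertexless_triangle:
  assumes "l1 \<in> Lns" "l2 \<in> Lns" "l3 \<in> Lns" "l1 \<inter> l2 \<inter> l3 = {}"
  shows "card (vertexless_triangle l1 l2 l3) = 3 * (q - 1)"
proof -
  obtain A B C where eqs: "l2 \<inter> l3 = {A}" "l1 \<inter> l3 = {B}" "l1 \<inter> l2 = {C}"
    and mem: "A \<in> l2" "A \<in> l3" "A \<notin> l1" "B \<in> l1" "B \<in> l3" "B \<notin> l2" "C \<in> l1" "C \<in> l2" "C \<notin> l3"
    using assms(1-4) by (rule triangleE)
  have "vertexless_triangle l1 l2 l3 = (l1 \<union> l2 \<union> l3) - {A, B, C}"
    unfolding eqs by blast
  moreover have "{A, B, C} \<subseteq> l1 \<union> l2 \<union> l3" using mem by blast
  moreover have "A \<noteq> B" "A \<noteq> C" "B \<noteq> C" using mem by blast+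
  ultimately show ?thesis
    using card_triangle[OF assms] by (simp add: card_Diff_subset del: Diff_insert)
qed

lemma card_compl_vertexless_triangle:
  assumes "l1 \<in> Lns" "l2 \<in> Lns" "l3 \<in> Lns" "l1 \<inter> l2 \<inter> l3 = {}"
  shows "card (Pts - vertexless_triangle l1 l2 l3) = q ^ 2 - 2 * q + 4"
proof -
  have sub: "vertexless_triangle l1 l2 l3 \<subseteq> Pts" using line_subset assms(1-3) by blast
  have "l1 \<noteq> {}" using card_line[OF assms(1)] by auto
  then obtain G where "G \<in> Pts" using line_subset[OF assms(1)] by blast
  then have "card (Pts - vertexless_triangle l1 l2 l3) = 1 + (q + 1) * q - 3 * (q - 1)"
    using sub card_Pts card_vertexless_triangle[OF assms] finite_subset[OF sub finite_Pts]
    by (simp only: card_Diff_subset)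
  \<comment> \<open>Writing q as k + 2 removes the truncated subtractions.\<close>
  moreover obtain k where "q = k + 2" using order_ge_2 le_Suc_ex by (metis add.commute)
  ultimately show ?thesis by (simp add: power2_eq_square algebra_simps)
qed

text \<open>The side \<open>l1\<close> keeps only \<open>B\<close> and \<open>C\<close> and adds 1.
  The line \<open>PA\<close> loses only \<open>P\<close>, because it meets the other sides in the
  retained vertex \<open>A\<close>, and so keeps q points. The other q - 1 lines pass through no
  vertex, lose three points and keep q - 2.\<close>

lemma secants_compl_vertexless_triangle_side:
  assumes "l1 \<in> Lns" "l2 \<in> Lns" "l3 \<in> Lns" "l1 \<inter> l2 \<inter> l3 = {}"
    and P: "P \<in> vertexless_triangle l1 l2 l3" "P \<in> l1"
  shows "secants (Pts - vertexless_triangle l1 l2 l3) P =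
    1 + (q choose 2) + (q - 1) * ((q - 2) choose 2)"
proof -
  obtain A B C where eqs: "l2 \<inter> l3 = {A}" "l1 \<inter> l3 = {B}" "l1 \<inter> l2 = {C}"
    and mem: "A \<in> l2" "A \<in> l3" "A \<notin> l1" "B \<in> l1" "B \<in> l3" "B \<notin> l2" "C \<in> l1" "C \<in> l2" "C \<notin> l3"
    using assms(1-4) by (rule triangleE)
  let ?T = "vertexless_triangle l1 l2 l3"
  have P': "P \<noteq> A" "P \<noteq> B" "P \<noteq> C" "P \<notin> l2" "P \<notin> l3"
    using mem P by blast+
  have pts: "A \<in> Pts" "P \<in> Pts" "B \<noteq> C"
    using mem P line_subset[OF assms(1)] line_subset[OF assms(2)] by blast+
  obtain a where a: "a \<in> pencil P" "A \<in> a" using pts P'(1) pencil_join[of P A] by auto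
  have l1: "l1 \<in> pencil P" "a \<noteq> l1" using P(2) assms(1) a mem by (auto simp: pencil_def)
  have Diff: "card (l \<inter> (Pts - ?T)) = q + 1 - card (l \<inter> ?T)" if "l \<in> Lns" for l
  proof -
    have "l \<inter> (Pts - ?T) = l - l \<inter> ?T" using line_subset[OF that] by blast
    then show ?thesis
      using card_line[OF that] finite_line[OF that] by (metis card_Diff_subset finite_Int inf_le1)
  qed
  have "l1 \<inter> (Pts - ?T) = {B, C}"
    unfolding eqs using mem line_subset[OF assms(1)] by blast
  then have 1: "card (l1 \<inter> (Pts - ?T)) = 2" using pts(3) by simp
  have side: "l \<inter> l1 = {P}" if "l \<in> pencil P" "l \<noteq> l1" for l
    using that P(2) assms(1) by (intro Int_eq_singleton) (auto simp: pencil_def)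
  have aL: "a \<in> Lns" "P \<in> a" using a(1) by (simp_all add: pencil_def)
  have "a \<noteq> l2" "a \<noteq> l3" using aL P' by blast+
  then have "a \<inter> l2 = {A}" "a \<inter> l3 = {A}"
    using aL a(2) mem assms(2,3) by (simp_all add: Int_eq_singleton)
  moreover have "a \<inter> ?T = (a \<inter> l1 \<union> a \<inter> l2 \<union> a \<inter> l3) - {A, B, C}"
    unfolding eqs by blast
  ultimately have "a \<inter> ?T = {P}" using side[OF a(1) l1(2)] P' by auto
  then have 2: "card (a \<inter> (Pts - ?T)) = q" using Diff[OF aL(1)] by simp
  have 3: "card (l \<inter> (Pts - ?T)) choose 2 = (q - 2) choose 2" if "l \<in> pencil P - {l1, a}" for l
  proof -
    have l: "l \<in> pencil P" "l \<in> Lns" "P \<in> l" "l \<noteq> l1" "l \<noteq> a" "l \<noteq> l2" "l \<noteq> l3"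
      using that P'(4,5) by (auto simp: pencil_def)
    have "A \<notin> l" using line_unique[of l a P A] l aL a(2) P'(1) by blast
    moreover have "B \<notin> l" using line_unique[of l l1 P B] l mem P'(2) P(2) assms(1) by blast
    moreover have "C \<notin> l" using line_unique[of l l1 P C] l mem P'(3) P(2) assms(1) by blast
    ultimately have nv: "A \<notin> l" "B \<notin> l" "C \<notin> l" .
    then have "card (l \<inter> (l1 \<union> l2 \<union> l3)) = 3"
      by (intro card_Int_triangle_no_vertex) (use l assms(1-3) in \<open>simp_all add: eqs\<close>)
    moreover have "l \<inter> ?T = l \<inter> (l1 \<union> l2 \<union> l3)" unfolding eqs using nv by blast
    ultimately show ?thesis using Diff[OF l(2)] by simp
  qed
  show ?thesis
    unfolding secants_def
    using sum_pencil_const[of P "{l1, a}", OF _ _ 3] pts(2) a(1) l1 1 2 by simp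
qed

text \<open>By symmetry, the side containing \<open>P\<close> may be moved to the first
  position.\<close>

lemma secants_compl_vertexless_triangle:
  assumes "l1 \<in> Lns" "l2 \<in> Lns" "l3 \<in> Lns" "l1 \<inter> l2 \<inter> l3 = {}"
    and P: "P \<in> vertexless_triangle l1 l2 l3"
  shows "secants (Pts - vertexless_triangle l1 l2 l3) P =
    1 + (q choose 2) + (q - 1) * ((q - 2) choose 2)"
proof -
  have perm: "vertexless_triangle l2 l1 l3 = vertexless_triangle l1 l2 l3"
    "vertexless_triangle l3 l1 l2 = vertexless_triangle l1 l2 l3" by blast+
  have "l2 \<inter> l1 \<inter> l3 = {}" "l3 \<inter> l1 \<inter> l2 = {}" using assms(4) by blast+
  moreover have "P \<in> l1 \<or> P \<in> l2 \<or> P \<in> l3" using P by blast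
  ultimately show ?thesis
    using secants_compl_vertexless_triangle_side[of l1 l2 l3 P]
      secants_compl_vertexless_triangle_side[of l2 l1 l3 P]
      secants_compl_vertexless_triangle_side[of l3 l1 l2 P] assms perm by auto
qed

end

section \<open>Saturating sets\<close>

lemma card_field_ge_2: "2 \<le> CARD('a::{finite,field})"
  using card_mono[of UNIV "{0, 1 :: 'a}"] by simp

interpretation pg: finite_projective_plane
  "pg_points :: 'a::{finite,field} vec3 set set" pg_lines "CARD('a)"
proof
  show "l \<subseteq> pg_points" if "l \<in> pg_lines" for l :: "'a vec3 set set"
    using that pg_line_subset by (metis pg_linesE)
  show "card l = CARD('a) + 1" if "l \<in> pg_lines" for l :: "'a vec3 set set"
    using that by (rule pg_linesE) (simp add: card_pg_line)
qed (simp_all add: pg_points_join pg_lines_meet card_pg_lines_through card_field_ge_2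
    del: One_nat_def add_Suc_right)

text \<open>Properness follows from a strict inequality of sizes, and the exact secant sums give the
  lower bound of saturation as well.\<close>

lemma optimal_saturatingI:
  fixes S :: "'a::{finite,field} vec3 set set"
  assumes "S \<subseteq> pg_points" "pg_spans S" "card S < card (pg_points :: 'a vec3 set set)"
    and "\<And>P. P \<in> pg_points - S \<Longrightarrow> pg.secants S P = \<mu>"
  shows "optimal_saturating S \<mu>"
proof -
  have "secant_sum S P = pg.secants S P" for P
    unfolding secant_sum_def pg.secants_def pg.pencil_def
    \<comment> \<open>The lines left out of \<open>secant_sum\<close> have at most one point in
      \<open>S\<close>, so their binomial coefficient is 0.\<close>
    by (rule sum.mono_neutral_left) auto
  then show ?thesis
    using assms unfolding optimal_saturating_def saturating_def by auto
qed

lemma concurrent_lines_optimal_saturating: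
  fixes G :: "'a::{finite,field} vec3 set"
  assumes G: "G \<in> pg_points" and Ls: "Ls \<subseteq> pg.pencil G" and L: "2 \<le> card Ls" "card Ls \<le> CARD('a)"
  shows "optimal_saturating (\<Union>Ls) ((card Ls choose 2) * CARD('a))"
proof (rule optimal_saturatingI)
  have ne: "Ls \<noteq> {}" using L by auto
  show sub: "\<Union>Ls \<subseteq> pg_points" using Ls pg.Union_pencil[OF G] by blast
  \<comment> \<open>An infinite set has \<open>card\<close> 0, so the lower bound on the cardinality
    also yields finiteness.\<close>
  have "finite Ls" "\<not> card Ls \<le> Suc 0" using L(1) by (auto intro: card_ge_0_finite)
  then obtain l m where "l \<in> Ls" "m \<in> Ls" "l \<noteq> m" by (metis card_le_Suc0_iff_eq)
  then show "pg_spans (\<Union>Ls)"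
    using Ls sub by (intro pg_spans_if_two_lines[of l m]) (auto simp: pg.pencil_def)
  have "card Ls * CARD('a) < (CARD('a) + 1) * CARD('a)"
    using L(2) card_field_ge_2[where 'a='a] by (intro mult_strict_right_mono) auto
  then show "card (\<Union>Ls) < card (pg_points :: 'a vec3 set set)"
    using pg.card_Union_concurrent[OF Ls ne] pg.card_Pts[OF G] by simp
  show "pg.secants (\<Union>Ls) P = (card Ls choose 2) * CARD('a)" if "P \<in> pg_points - \<Union>Ls" for P
    using pg.secants_concurrent_lines[OF G Ls ne that] .
qed

text \<open>Two of the full lines already span, and the set is proper because \<open>m\<close> has q
  points besides \<open>G\<close> while \<open>B\<close> has fewer.\<close>

lemma concurrent_lines_Un_points_optimal_saturating:
  fixes G :: "'a::{finite,field} vec3 set"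
  assumes G: "G \<in> pg_points" and Ls: "Ls \<subseteq> pg.pencil G" "card Ls = CARD('a)"
    and m: "m \<in> pg.pencil G" "m \<notin> Ls" and B: "B \<subseteq> m - {G}" "card B < CARD('a)"
  shows "optimal_saturating (\<Union>Ls \<union> B) (((card B + 1) choose 2) + (CARD('a) choose 2) * CARD('a))"
proof (rule optimal_saturatingI)
  have L: "2 \<le> card Ls" using Ls card_field_ge_2[where 'a='a] by simp
  then have ne: "Ls \<noteq> {}" by auto
  show sub: "\<Union>Ls \<union> B \<subseteq> pg_points" using Ls m B pg.Union_pencil[OF G] by blast
  have "finite Ls" "\<not> card Ls \<le> Suc 0" using L by (auto intro: card_ge_0_finite)
  then obtain l k where "l \<in> Ls" "k \<in> Ls" "l \<noteq> k" by (metis card_le_Suc0_iff_eq)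
  then show "pg_spans (\<Union>Ls \<union> B)"
    using Ls(1) sub by (intro pg_spans_if_two_lines[of l k]) (auto simp: pg.pencil_def)
  show "card (\<Union>Ls \<union> B) < card (pg_points :: 'a vec3 set set)"
    using pg.card_concurrent_lines_Un_points[OF Ls(1) ne m B(1)] pg.card_Pts[OF G] Ls(2) B(2) by simp
  show "pg.secants (\<Union>Ls \<union> B) P = ((card B + 1) choose 2) + (CARD('a) choose 2) * CARD('a)"
    if "P \<in> pg_points - (\<Union>Ls \<union> B)" for P
    using pg.secants_concurrent_lines_Un_points[OF G Ls m B(1) that] .
qed

lemma triangle_optimal_saturating:
  fixes l1 :: "'a::{finite,field} vec3 set set"
  assumes l: "l1 \<in> pg_lines" "l2 \<in> pg_lines" "l3 \<in> pg_lines" "l1 \<inter> l2 \<inter> l3 = {}"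
  shows "optimal_saturating (l1 \<union> l2 \<union> l3) (3 * (CARD('a) - 1))"
proof (rule optimal_saturatingI)
  obtain A B C where "l2 \<inter> l3 = {A}" "l1 \<inter> l3 = {B}" "l1 \<inter> l2 = {C}"
    and mem: "A \<in> l2" "A \<in> l3" "A \<notin> l1" "B \<in> l1" "B \<in> l3" "B \<notin> l2" "C \<in> l1" "C \<in> l2" "C \<notin> l3"
    using l by (rule pg.triangleE)
  show sub: "l1 \<union> l2 \<union> l3 \<subseteq> pg_points" using pg.line_subset[OF l(1)] pg.line_subset[OF l(2)] pg.line_subset[OF l(3)] by simp
  show "pg_spans (l1 \<union> l2 \<union> l3)"
    using l(1,2) mem sub by (intro pg_spans_if_two_lines[of l1 l2]) auto
  have "A \<in> pg_points" using mem sub by blast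
  \<comment> \<open>The plane has (q - 1)^2 points more than the triangle; the substitution q = k +
    2 makes this visibly positive.\<close>
  moreover obtain k where "CARD('a) = k + 2"
    using card_field_ge_2[where 'a='a] le_Suc_ex by (metis add.commute)
  ultimately show "card (l1 \<union> l2 \<union> l3) < card (pg_points :: 'a vec3 set set)"
    using pg.card_triangle[OF l] pg.card_Pts[of A] by (simp add: algebra_simps)
  show "pg.secants (l1 \<union> l2 \<union> l3) P = 3 * (CARD('a) - 1)"
    if "P \<in> pg_points - (l1 \<union> l2 \<union> l3)" for P
    using pg.secants_triangle[OF l that] .
qed

lemma compl_vertexless_triangle_optimal_saturating:
  fixes l1 :: "'a::{finite,field} vec3 set set"
  assumes l: "l1 \<in> pg_lines" "l2 \<in> pg_lines" "l3 \<in> pg_lines" "l1 \<inter> l2 \<inter> l3 = {}"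
  shows "optimal_saturating (pg_points - pg.vertexless_triangle l1 l2 l3)
    (1 + (CARD('a) choose 2) + (CARD('a) - 1) * ((CARD('a) - 2) choose 2))"
proof (rule optimal_saturatingI)
  let ?T = "pg.vertexless_triangle l1 l2 l3"
  obtain A B C where "l2 \<inter> l3 = {A}" "l1 \<inter> l3 = {B}" "l1 \<inter> l2 = {C}"
    and mem: "A \<in> l2" "A \<in> l3" "A \<notin> l1" "B \<in> l1" "B \<in> l3" "B \<notin> l2" "C \<in> l1" "C \<in> l2" "C \<notin> l3"
    using l by (rule pg.triangleE)
  have pts: "A \<in> pg_points" "B \<in> pg_points" "C \<in> pg_points"
    using mem pg.line_subset[OF l(1)] pg.line_subset[OF l(2)] by blast+
  show "pg_points - ?T \<subseteq> pg_points" by (rule Diff_subset)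
  show "pg_spans (pg_points - ?T)"
  \<comment> \<open>Every line meets \<open>?T\<close>, so the set contains no whole line; the three
    retained vertices are used to span instead.\<close>
  proof (rule pg_spans_if_not_collinear)
    show "B \<in> pg_points - ?T" "C \<in> pg_points - ?T" "A \<in> pg_points - ?T" using mem pts by auto
    show "B \<noteq> C" using mem by blast
    show "A \<notin> k" if "k \<in> pg_lines" "B \<in> k" "C \<in> k" for k
      using pg.line_unique[of k l1 B C] that l(1) mem by blast
  qed (rule Diff_subset)
  \<comment> \<open>Each side keeps q - 1 points after losing its vertices, so something is removed
    from the plane even for q = 2.\<close>
  have "card ?T > 0"
    using pg.card_vertexless_triangle[OF l] card_field_ge_2[where 'a='a] by simp
  then have "?T \<noteq> {}" by (metis card.empty less_irrefl)
  then obtain X where "X \<in> ?T" by (metis ex_in_conv)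
  moreover have "X \<in> pg_points" using \<open>X \<in> ?T\<close> pg.line_subset l(1-3) by blast
  ultimately show "card (pg_points - ?T) < card (pg_points :: 'a vec3 set set)"
    by (intro psubset_card_mono) auto
  show "pg.secants (pg_points - ?T) P =
      1 + (CARD('a) choose 2) + (CARD('a) - 1) * ((CARD('a) - 2) choose 2)"
    if "P \<in> pg_points - (pg_points - ?T)" for P
    using pg.secants_compl_vertexless_triangle[OF l] that by blast
qed

theorem theorem7p3:
  fixes q :: nat
  assumes q: "q = CARD('a)"
  shows
   "(\<forall>(G :: ('a::{finite,field}) vec3 set) (Ls :: 'a vec3 set set set) L.
        G \<in> pg_points \<and> Ls \<subseteq> pg_lines \<and> (\<forall>l \<in> Ls. G \<in> l) \<and> card Ls = L \<and>
        2 \<le> L \<and> L \<le> q \<longrightarrow>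
        card (\<Union>Ls) = 1 + L * q \<and> optimal_saturating (\<Union>Ls) ((L choose 2) * q))
  \<and> (\<forall>(G :: 'a vec3 set) (Ls :: 'a vec3 set set set) m B b.
        G \<in> pg_points \<and> Ls \<subseteq> pg_lines \<and> (\<forall>l \<in> Ls. G \<in> l) \<and> card Ls = q \<and>
        m \<in> pg_lines \<and> G \<in> m \<and> m \<notin> Ls \<and> B \<subseteq> m - {G} \<and> card B = b \<and>
        1 \<le> b \<and> b \<le> q - 1 \<longrightarrow>
        card (\<Union>Ls \<union> B) = 1 + q ^ 2 + b \<and>
        optimal_saturating (\<Union>Ls \<union> B) (((b + 1) choose 2) + (q choose 2) * q))
  \<and> (\<forall>(l1 :: 'a vec3 set set) l2 l3.
        l1 \<in> pg_lines \<and> l2 \<in> pg_lines \<and> l3 \<in> pg_lines \<and> l1 \<inter> l2 \<inter> l3 = {} \<longrightarrow>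
        card (l1 \<union> l2 \<union> l3) = 3 * q \<and> optimal_saturating (l1 \<union> l2 \<union> l3) (3 * (q - 1)))
  \<and> (\<forall>(l1 :: 'a vec3 set set) l2 l3 T.
        l1 \<in> pg_lines \<and> l2 \<in> pg_lines \<and> l3 \<in> pg_lines \<and> l1 \<inter> l2 \<inter> l3 = {} \<and>
        T = (l1 \<union> l2 \<union> l3) - ((l1 \<inter> l2) \<union> (l1 \<inter> l3) \<union> (l2 \<inter> l3)) \<longrightarrow>
        card (pg_points - T) = q ^ 2 - 2 * q + 4 \<and>
        optimal_saturating (pg_points - T) (1 + (q choose 2) + (q - 1) * ((q - 2) choose 2)))"
\<comment> \<open>The conclusions are split too, so each of the four families gives two goals, size
  and optimality, both settled in one block.\<close>
proof (intro conjI allI impI; (elim conjE)?)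
  fix G :: "'a vec3 set" and Ls L
  assume G: "G \<in> pg_points" and "Ls \<subseteq> pg_lines" "\<forall>l \<in> Ls. G \<in> l"
    and L: "card Ls = L" "2 \<le> L" "L \<le> q"
  then have Ls: "Ls \<subseteq> pg.pencil G" by (auto simp: pg.pencil_def)
  have "Ls \<noteq> {}" using L by auto
  then show "card (\<Union>Ls) = 1 + L * q"
    using pg.card_Union_concurrent[OF Ls] L(1) q by simp
  show "optimal_saturating (\<Union>Ls) ((L choose 2) * q)"
    using concurrent_lines_optimal_saturating[OF G Ls] L q by simp
next
  fix G :: "'a vec3 set" and Ls m B b
  assume G: "G \<in> pg_points" and "Ls \<subseteq> pg_lines" "\<forall>l \<in> Ls. G \<in> l" and c: "card Ls = q"
    and "m \<in> pg_lines" "G \<in> m" and m: "m \<notin> Ls" and B: "B \<subseteq> m - {G}" "card B = b"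
    and b: "1 \<le> b" "b \<le> q - 1"
  then have Ls: "Ls \<subseteq> pg.pencil G" and mG: "m \<in> pg.pencil G" by (auto simp: pg.pencil_def)
  \<comment> \<open>The bounds on \<open>b\<close> force q to be at least 2, so the family of q
    lines is nonempty.\<close>
  have "card Ls \<noteq> 0" using c b by simp
  then have "Ls \<noteq> {}" by auto
  then show "card (\<Union>Ls \<union> B) = 1 + q ^ 2 + b"
    using pg.card_concurrent_lines_Un_points[OF Ls _ mG m B(1)] c B(2) q
    by (simp add: power2_eq_square)
  show "optimal_saturating (\<Union>Ls \<union> B) (((b + 1) choose 2) + (q choose 2) * q)"
    using concurrent_lines_Un_points_optimal_saturating[OF G Ls _ mG m B(1)] c B(2) b q by simp
next
  fix l1 l2 l3 :: "'a vec3 set set"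
  assume l: "l1 \<in> pg_lines" "l2 \<in> pg_lines" "l3 \<in> pg_lines" "l1 \<inter> l2 \<inter> l3 = {}"
  show "card (l1 \<union> l2 \<union> l3) = 3 * q"
    using pg.card_triangle[OF l] q by simp
  show "optimal_saturating (l1 \<union> l2 \<union> l3) (3 * (q - 1))"
    using triangle_optimal_saturating[OF l] q by simp
next
  fix l1 l2 l3 T :: "'a vec3 set set"
  assume l: "l1 \<in> pg_lines" "l2 \<in> pg_lines" "l3 \<in> pg_lines" "l1 \<inter> l2 \<inter> l3 = {}"
    and T: "T = (l1 \<union> l2 \<union> l3) - ((l1 \<inter> l2) \<union> (l1 \<inter> l3) \<union> (l2 \<inter> l3))"
  show "card (pg_points - T) = q ^ 2 - 2 * q + 4"
    unfolding T q by (rule pg.card_compl_vertexless_triangle[OF l])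
  show "optimal_saturating (pg_points - T) (1 + (q choose 2) + (q - 1) * ((q - 2) choose 2))"
    unfolding T q by (rule compl_vertexless_triangle_optimal_saturating[OF l])
qed

end
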